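(* Let $n\ge 1$. There exists a constant $C_n>0$, depending only on $n$, such that for every bounded Lipschitz domain $\Omega\subset\mathbb{R}^n$ and every $\lambda>0$, $$\mu_\lambda(\Omega)\le C_n\big(|\Omega|+\lambda\,\mathcal{H}^{n-1}(\partial\Omega)\big).$$
   Context: Work in $\mathbb{R}^n$ with the Euclidean metric; $\operatorname{diam}$ is Euclidean diameter, $|E|$ is Lebesgue measure of $E$, and $\mathcal{H}^{s}$ is $s$-dimensional Hausdorff measure. For $\lambda>0$ the mixed gauge is $h_\lambda(r)=r^n+\lambda r^{n-1}$ for $r>0$, with $h_\lambda(0)=0$. For $E\subset\mathbb{R}^n$ define $$\mu_\lambda(E):=\inf\Big\{\sum_i \big((\operatorname{diam} U_i)^n+\lambda(\operatorname{diam} U_i)^{n-1}\big) : E\subset\bigcup_i U_i\Big\},$$ where the infimum is over all at most countable families $(U_i)$ of balls (or, alternatively, of cubes; the choice of family is fixed once and for all, and the claim is made for either choice) of positive diameter, the empty family being allowed for $E=\emptyset$, so $\mu_\lambda(\emptyset)=0$. There is no restriction on the size of the diameters. *)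

theory Defs
  imports "HOL-Analysis.Analysis"
begin

text \<open>
  At most countable families are written as \<open>U :: nat \<Rightarrow> 'a set\<close> restricted to an index set
  \<open>I :: nat set\<close>; finite and empty families are included. All quantities take values in
  \<^typ>\<open>ennreal\<close>, where infinite sums of nonnegative terms always exist.
\<close>

definition mixed_gauge :: "nat \<Rightarrow> real \<Rightarrow> real \<Rightarrow> real" where
  "mixed_gauge n lam r = (if r = 0 then 0 else r ^ n + lam * r ^ (n - 1))"

text \<open>
  Open balls and open axis-parallel cubes. Passing to closures does not change diameters, so
  these families give an infimum at least as large as that of the corresponding closed (or mixed)
  families, and arbitrarily rotated cubes only enlarge the family of competitors.
\<close>

definition balls :: "'a::euclidean_space set set" where
  "balls = {ball x r | x r. 0 < r}"

definition cubes :: "'a::euclidean_space set set" where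
  "cubes = {box a (a + r *\<^sub>R One) | a r. 0 < r}"

definition mixed_content :: "'a::euclidean_space set set \<Rightarrow> real \<Rightarrow> 'a set \<Rightarrow> ennreal" where
  "mixed_content \<F> lam E =
     Inf {\<Sum>\<^sub>\<infinity>i\<in>I. ennreal (mixed_gauge DIM('a) lam (diameter (U i))) | (I :: nat set) U.
            (\<forall>i\<in>I. U i \<in> \<F>) \<and> E \<subseteq> (\<Union>i\<in>I. U i)}"

text \<open>
  Hausdorff measure of integer dimension \<open>s\<close>, without the normalising factor
  \<open>\<omega>\<^sub>s / 2 ^ s\<close>. Covering sets are required to be nonempty and \<open>0 ^ 0 = 1\<close>, so for \<open>s = 0\<close>
  every covering set contributes \<open>1\<close> and the result is counting measure. Boundedness is required
  because \<^const>\<open>diameter\<close> is meaningless on unbounded sets.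
\<close>

definition hausdorff_premeasure :: "nat \<Rightarrow> real \<Rightarrow> 'a::metric_space set \<Rightarrow> ennreal" where
  "hausdorff_premeasure s \<delta> A =
     Inf {\<Sum>\<^sub>\<infinity>i\<in>I. ennreal (diameter (U i) ^ s) | (I :: nat set) U.
            (\<forall>i\<in>I. U i \<noteq> {} \<and> bounded (U i) \<and> diameter (U i) \<le> \<delta>) \<and> A \<subseteq> (\<Union>i\<in>I. U i)}"

definition hausdorff_measure :: "nat \<Rightarrow> 'a::metric_space set \<Rightarrow> ennreal" where
  "hausdorff_measure s A = (SUP \<delta>\<in>{0<..}. hausdorff_premeasure s \<delta> A)"

text \<open>
  Near each boundary point, \<open>\<Omega>\<close> is the strict epigraph of a Lipschitz function \<open>\<gamma>\<close> in rotated
  coordinates: the unit vector \<open>\<nu>\<close> is the vertical axis, its orthogonal complement is the copy of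
  \<open>\<real>\<^sup>n\<^sup>-\<^sup>1\<close> on which \<open>\<gamma>\<close> lives, and \<open>y - (y \<bullet> \<nu>) *\<^sub>R \<nu>\<close> are the horizontal coordinates of \<open>y\<close>.
  Connectedness is not part of the definition, as authors differ on whether a Lipschitz domain
  is connected.
\<close>

definition lipschitz_domain :: "'a::euclidean_space set \<Rightarrow> bool" where
  "lipschitz_domain \<Omega> \<longleftrightarrow> open \<Omega> \<and>
     (\<forall>x\<in>frontier \<Omega>. \<exists>r>0. \<exists>\<nu> L \<gamma>. norm \<nu> = 1 \<and> L-lipschitz_on {z. z \<bullet> \<nu> = 0} \<gamma> \<and>
        \<Omega> \<inter> ball x r = {y \<in> ball x r. \<gamma> (y - (y \<bullet> \<nu>) *\<^sub>R \<nu>) < y \<bullet> \<nu>})"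

end

theory Submission
  imports Defs
begin

text \<open>
  Around every \<open>x \<in> \<Omega>\<close> choose a cube \<open>Q\<close> of which \<open>\<Omega>\<close> fills at most one half but at least a fixed
  fraction. Then \<open>\<bar>Q\<bar>\<close> is controlled by \<open>\<bar>Q \<inter> \<Omega>\<bar>\<close>, and a relative isoperimetric inequality bounds
  the \<open>(n - 1)\<close>-st power of the side by any cover of the frontier of \<open>\<Omega>\<close> inside \<open>Q\<close>. Vitali's covering
  lemma selects disjoint cubes whose dilates cover \<open>\<Omega>\<close>, and both estimates add up.

  The isoperimetric inequality is elementary because it refers to the whole topological frontier:
  walk from a point of \<open>Q \<inter> \<Omega>\<close> to a point of \<open>Q - \<Omega>\<close> by changing one coordinate at a time. Some
  step leaves or enters \<open>\<Omega>\<close>, so its starting point lies in the shadow of the frontier along that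
  coordinate direction. Exchanging coordinates between the two points preserves the product measure,
  so \<open>\<bar>Q \<inter> \<Omega>\<bar> \<bar>Q - \<Omega>\<bar>\<close> is at most \<open>\<bar>Q\<bar>\<close> times the sum of the measures of the \<open>n\<close> shadows.
\<close>

section \<open>Sums and countable subadditivity in the extended nonnegative reals\<close>

lemma finite_sum_le_infsum_ennreal:
  fixes f :: "'a \<Rightarrow> ennreal"
  assumes "finite F" "F \<subseteq> I"
  shows "sum f F \<le> infsum f I"
proof -
  have "infsum f F \<le> infsum f I"
    using assms by (intro infsum_mono_neutral nonneg_summable_on_complete) auto
  then show ?thesis using assms by simp
qed

lemma infsum_cmult_le_ennreal:
  fixes f :: "'a \<Rightarrow> ennreal"
  shows "(\<Sum>\<^sub>\<infinity>i\<in>I. c * f i) \<le> c * (\<Sum>\<^sub>\<infinity>i\<in>I. f i)"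
proof (rule infsum_le_finite_sums)
  fix F assume F: "finite F" "F \<subseteq> I"
  have "(\<Sum>i\<in>F. c * f i) = c * (\<Sum>i\<in>F. f i)"
    by (simp add: sum_distrib_left)
  also have "\<dots> \<le> c * (\<Sum>\<^sub>\<infinity>i\<in>I. f i)"
    using F by (intro mult_left_mono finite_sum_le_infsum_ennreal) auto
  finally show "(\<Sum>i\<in>F. c * f i) \<le> c * (\<Sum>\<^sub>\<infinity>i\<in>I. f i)" .
qed (intro nonneg_summable_on_complete, simp)

lemma emeasure_UN_le_infsum:
  fixes I :: "nat set"
  assumes "\<And>i. i \<in> I \<Longrightarrow> A i \<in> sets M"
  shows "emeasure M (\<Union>i\<in>I. A i) \<le> (\<Sum>\<^sub>\<infinity>i\<in>I. emeasure M (A i))"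
proof -
  define B where "B i = (if i \<in> I then A i else {})" for i
  have "emeasure M (\<Union>i\<in>I. A i) = emeasure M (\<Union>i. B i)"
    by (rule arg_cong[where f = "emeasure M"]) (auto simp: B_def split: if_splits)
  also have "\<dots> \<le> (\<Sum>i. emeasure M (B i))"
    using assms by (intro emeasure_subadditive_countably) (auto simp: B_def)
  also have "\<dots> \<le> (\<Sum>\<^sub>\<infinity>i\<in>I. emeasure M (A i))"
  proof -
    have "(\<Sum>i<m. emeasure M (B i)) \<le> (\<Sum>\<^sub>\<infinity>i\<in>I. emeasure M (A i))" for m
    proof -
      have "(\<Sum>i<m. emeasure M (B i)) = (\<Sum>i\<in>{..<m} \<inter> I. emeasure M (A i))"
        by (rule sum.mono_neutral_cong_right) (auto simp: B_def)
      also have "\<dots> \<le> (\<Sum>\<^sub>\<infinity>i\<in>I. emeasure M (A i))"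
        by (intro finite_sum_le_infsum_ennreal) auto
      finally show ?thesis .
    qed
    then show ?thesis
      by (simp add: suminf_eq_SUP SUP_le_iff)
  qed
  finally show ?thesis .
qed

text \<open>This lets one cover serve several cubes: each cube is charged only for the cover sets
  that meet it, and no set is charged twice.\<close>

lemma sum_infsum_disjoint_le_ennreal:
  fixes f :: "'a \<Rightarrow> ennreal"
  assumes "finite F" "\<And>x. x \<in> F \<Longrightarrow> J x \<subseteq> I"
    and "\<And>x y. x \<in> F \<Longrightarrow> y \<in> F \<Longrightarrow> x \<noteq> y \<Longrightarrow> J x \<inter> J y = {}"
  shows "(\<Sum>x\<in>F. \<Sum>\<^sub>\<infinity>i\<in>J x. f i) \<le> (\<Sum>\<^sub>\<infinity>i\<in>I. f i)"
proof -
  have "(\<Sum>x\<in>F. \<Sum>\<^sub>\<infinity>i\<in>J x. f i) = (\<Sum>\<^sub>\<infinity>i\<in>(\<Union>x\<in>F. J x). f i)"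
    using assms(1,3)
  proof (induction F rule: finite_induct)
    case (insert x F)
    have "J x \<inter> J y = {}" if "y \<in> F" for y
      using insert.hyps(2) insert.prems[of x y] that by blast
    then have "J x \<inter> (\<Union>y\<in>F. J y) = {}" by blast
    then have "(\<Sum>\<^sub>\<infinity>i\<in>J x \<union> (\<Union>y\<in>F. J y). f i) = (\<Sum>\<^sub>\<infinity>i\<in>J x. f i) + (\<Sum>\<^sub>\<infinity>i\<in>(\<Union>y\<in>F. J y). f i)"
      by (intro infsum_Un_disjoint nonneg_summable_on_complete) auto
    moreover have "(\<Sum>y\<in>F. \<Sum>\<^sub>\<infinity>i\<in>J y. f i) = (\<Sum>\<^sub>\<infinity>i\<in>(\<Union>y\<in>F. J y). f i)"
      by (rule insert.IH) (rule insert.prems, auto)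
    ultimately show ?case
      using insert.hyps by simp
  qed simp
  also have "\<dots> \<le> (\<Sum>\<^sub>\<infinity>i\<in>I. f i)"
    using assms(2) by (intro infsum_mono_neutral nonneg_summable_on_complete) auto
  finally show ?thesis .
qed

section \<open>Exchange of coordinates and Lebesgue measure\<close>

text \<open>Lebesgue measure is determined by its values on boxes, and the preimage of a box is a
  box with permuted side lengths. As \<open>\<pi>\<close> is its own inverse, the corners of the
  preimage are \<open>T l\<close> and \<open>T u\<close>.\<close>

lemma distr_lborel_permute_Basis:
  fixes T :: "'a::euclidean_space \<Rightarrow> 'a"
  assumes inner: "\<And>x b. b \<in> Basis \<Longrightarrow> T x \<bullet> b = x \<bullet> \<pi> b"
    and Basis: "\<And>b. b \<in> Basis \<Longrightarrow> \<pi> b \<in> Basis"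
    and involution: "\<And>b. b \<in> Basis \<Longrightarrow> \<pi> (\<pi> b) = b"
  shows "T \<in> borel_measurable borel" "distr lborel borel T = lborel"
proof -
  show [measurable]: "T \<in> borel_measurable borel"
    by (subst borel_measurable_euclidean_space) (auto simp: inner)
  have bij: "bij_betw \<pi> Basis Basis"
    by (rule bij_betwI[where g = \<pi>]) (auto simp: Basis involution)
  show "distr lborel borel T = lborel"
  proof (rule lborel_eqI[symmetric])
    fix l u :: 'a assume le: "\<And>b. b \<in> Basis \<Longrightarrow> l \<bullet> b \<le> u \<bullet> b"
    have "T -` box l u = box (T l) (T u)"
    proof (intro set_eqI iffI)
      fix x assume "x \<in> T -` box l u"
      then have "l \<bullet> \<pi> b < T x \<bullet> \<pi> b \<and> T x \<bullet> \<pi> b < u \<bullet> \<pi> b" if "b \<in> Basis" for b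
        using Basis that by (auto simp: mem_box)
      then show "x \<in> box (T l) (T u)"
        using Basis by (simp add: mem_box inner involution)
    next
      fix x assume "x \<in> box (T l) (T u)"
      then have "T l \<bullet> \<pi> b < x \<bullet> \<pi> b \<and> x \<bullet> \<pi> b < T u \<bullet> \<pi> b" if "b \<in> Basis" for b
        using Basis that by (auto simp: mem_box)
      then show "x \<in> T -` box l u"
        using Basis by (simp add: mem_box inner involution)
    qed
    then have "emeasure (distr lborel borel T) (box l u) = emeasure lborel (box (T l) (T u))"
      by (simp add: emeasure_distr)
    also have "\<dots> = (\<Prod>b\<in>Basis. (u - l) \<bullet> \<pi> b)"
      by (simp add: emeasure_lborel_box_eq inner Basis le inner_diff_left)
    also have "(\<Prod>b\<in>Basis. (u - l) \<bullet> \<pi> b) = (\<Prod>b\<in>Basis. (u - l) \<bullet> b)"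
      by (rule prod.reindex_bij_betw[OF bij])
    finally show "emeasure (distr lborel borel T) (box l u) = (\<Prod>b\<in>Basis. (u - l) \<bullet> b)" .
  qed simp
qed

text \<open>As \<open>S\<close> grows from \<open>{}\<close> to \<open>Basis\<close>, these points
  form the walk from \<open>x\<close> to \<open>y\<close> parallel to the axes.\<close>

definition coord_merge :: "'a::euclidean_space set \<Rightarrow> 'a \<Rightarrow> 'a \<Rightarrow> 'a" where
  "coord_merge S x y = (\<Sum>b\<in>Basis. (if b \<in> S then y \<bullet> b else x \<bullet> b) *\<^sub>R b)"

lemma inner_coord_merge [simp]:
  "b \<in> Basis \<Longrightarrow> coord_merge S x y \<bullet> b = (if b \<in> S then y \<bullet> b else x \<bullet> b)"
  unfolding coord_merge_def by simp

lemma coord_merge_empty [simp]: "coord_merge {} x y = x"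
  by (rule euclidean_eqI) simp

lemma coord_merge_Basis [simp]: "coord_merge Basis x y = y"
  by (rule euclidean_eqI) simp

lemma coord_merge_in_cbox: "x \<in> cbox a b \<Longrightarrow> y \<in> cbox a b \<Longrightarrow> coord_merge S x y \<in> cbox a b"
  by (simp add: mem_box)

definition coord_swap :: "'a::euclidean_space set \<Rightarrow> 'a \<times> 'a \<Rightarrow> 'a \<times> 'a" where
  "coord_swap S p = (coord_merge S (fst p) (snd p), coord_merge S (snd p) (fst p))"

text \<open>On the product space the exchange only permutes basis vectors: it interchanges
  \<open>(b, 0)\<close> and \<open>(0, b)\<close> for each \<open>b\<close> in
  \<open>S\<close>.\<close>

lemma coord_swap_preserves_lborel:
  fixes S :: "'a::euclidean_space set"
  shows "coord_swap S \<in> borel_measurable borel" "distr lborel borel (coord_swap S) = lborel"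
proof -
  \<comment> \<open>A basis vector of the product has one zero component, so
    \<open>fst p + snd p\<close> recovers the basis vector of the factor.\<close>
  define \<pi> :: "'a \<times> 'a \<Rightarrow> 'a \<times> 'a"
    where "\<pi> p = (if fst p + snd p \<in> S then (snd p, fst p) else p)" for p
  have "coord_swap S x \<bullet> b = x \<bullet> \<pi> b" "\<pi> b \<in> Basis" "\<pi> (\<pi> b) = b" if "b \<in> Basis" for x b
    using that by (auto simp: Basis_prod_def \<pi>_def coord_swap_def inner_prod_def add.commute)
  note * = distr_lborel_permute_Basis[where T = "coord_swap S" and \<pi> = \<pi>, OF this]
  show "coord_swap S \<in> borel_measurable borel" "distr lborel borel (coord_swap S) = lborel"
    using * by auto
qed

section \<open>Relative isoperimetric inequality in a box\<close>

text \<open>Inside the box, the cylinder contains the shadow in direction \<open>k\<close> of any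
  set of diameter at most \<open>d\<close> through \<open>u\<close>. It fits in a box with the
  original side along \<open>k\<close> and sides \<open>2 * d\<close> in all other
  directions.\<close>

lemma emeasure_cylinder_le:
  fixes u :: "'a::euclidean_space"
  defines "Z \<equiv> \<lambda>k a b u d. {x \<in> cbox a b. \<forall>c\<in>Basis - {k}. \<bar>x \<bullet> c - u \<bullet> c\<bar> \<le> d}"
  assumes k: "k \<in> Basis" and d: "0 \<le> d" and le: "a \<bullet> k \<le> b \<bullet> k"
  shows "Z k a b u d \<in> sets borel"
    "emeasure lborel (Z k a b u d) \<le> ennreal ((b - a) \<bullet> k * (2 * d) ^ (DIM('a) - 1))"
proof -
  have "Z k a b u d = cbox a b \<inter> {x \<in> space borel. \<forall>c\<in>Basis - {k}. \<bar>x \<bullet> c - u \<bullet> c\<bar> \<le> d}"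
    by (auto simp: Z_def)
  also have "\<dots> \<in> sets borel"
    by (intro sets.Int) (simp, measurable)
  finally show "Z k a b u d \<in> sets borel" .
  define l where "l = (\<Sum>c\<in>Basis. (if c = k then a \<bullet> k else u \<bullet> c - d) *\<^sub>R c)"
  define v where "v = (\<Sum>c\<in>Basis. (if c = k then b \<bullet> k else u \<bullet> c + d) *\<^sub>R c)"
  have l: "l \<bullet> c = (if c = k then a \<bullet> k else u \<bullet> c - d)" if "c \<in> Basis" for c
    using that unfolding l_def by simp
  have v: "v \<bullet> c = (if c = k then b \<bullet> k else u \<bullet> c + d)" if "c \<in> Basis" for c
    using that unfolding v_def by simp
  have "Z k a b u d \<subseteq> cbox l v"
    using k by (auto simp: Z_def mem_box l v abs_le_iff algebra_simps)
  then have "emeasure lborel (Z k a b u d) \<le> emeasure lborel (cbox l v)"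
    by (intro emeasure_mono) auto
  also have "\<dots> \<le> ennreal (\<Prod>c\<in>Basis. (v - l) \<bullet> c)"
    by (simp add: emeasure_lborel_cbox_eq)
  also have "(\<Prod>c\<in>Basis. (v - l) \<bullet> c) = (v - l) \<bullet> k * (\<Prod>c\<in>Basis - {k}. (v - l) \<bullet> c)"
    using k by (intro prod.remove) auto
  also have "(\<Prod>c\<in>Basis - {k}. (v - l) \<bullet> c) = (\<Prod>c\<in>Basis - {k}. 2 * d)"
    by (rule prod.cong) (auto simp: inner_diff_left l v)
  also have "(v - l) \<bullet> k * \<dots> = (b - a) \<bullet> k * (2 * d) ^ (DIM('a) - 1)"
    using k by (simp add: inner_diff_left l v card_Diff_singleton)
  finally show "emeasure lborel (Z k a b u d) \<le> ennreal ((b - a) \<bullet> k * (2 * d) ^ (DIM('a) - 1))" .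
qed

text \<open>Induction over the coordinates in \<open>S\<close>, paying for one shadow at each step.
  Carrying a Borel superset \<open>W\<close> avoids a separate measurability argument for the
  mismatch set.\<close>

lemma emeasure_mismatch_le:
  fixes \<Omega> :: "'a::euclidean_space set"
  assumes S: "S \<subseteq> Basis" and \<Omega>: "\<Omega> \<in> sets borel"
    and shadow: "\<And>k. k \<in> Basis \<Longrightarrow> Z k \<in> sets borel"
      "\<And>k x y. k \<in> Basis \<Longrightarrow> x \<in> cbox a b \<Longrightarrow> y \<in> cbox a b \<Longrightarrow>
         x \<in> \<Omega> \<longleftrightarrow> coord_merge {k} x y \<notin> \<Omega> \<Longrightarrow> x \<in> Z k"
  obtains W where "W \<in> sets borel"
    "{(x, y). x \<in> cbox a b \<and> y \<in> cbox a b \<and> (x \<in> \<Omega> \<longleftrightarrow> coord_merge S x y \<notin> \<Omega>)} \<subseteq> W"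
    "emeasure lborel W \<le> (\<Sum>k\<in>S. emeasure lborel (Z k)) * emeasure lborel (cbox a b)"
proof -
  have "finite S" using S by (rule finite_subset) simp
  then have "\<exists>W\<in>sets borel.
    {(x, y). x \<in> cbox a b \<and> y \<in> cbox a b \<and> (x \<in> \<Omega> \<longleftrightarrow> coord_merge S x y \<notin> \<Omega>)} \<subseteq> W \<and>
    emeasure lborel W \<le> (\<Sum>k\<in>S. emeasure lborel (Z k)) * emeasure lborel (cbox a b)"
    using S
  proof (induction S rule: finite_induct)
    case empty
    show ?case by (intro bexI[of _ "{}"]) auto
  next
    case (insert k S)
    then obtain W where W: "W \<in> sets borel"
      "\<And>x y. x \<in> cbox a b \<Longrightarrow> y \<in> cbox a b \<Longrightarrow> x \<in> \<Omega> \<longleftrightarrow> coord_merge S x y \<notin> \<Omega> \<Longrightarrow> (x, y) \<in> W"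
      "emeasure lborel W \<le> (\<Sum>k\<in>S. emeasure lborel (Z k)) * emeasure lborel (cbox a b)"
      by auto
    \<comment> \<open>These are the pairs whose walk stands in the shadow \<open>Z k\<close> just
      before step \<open>k\<close>. The swap turns the condition into a product set without changing
      its measure.\<close>
    define V where "V = coord_swap S -` (Z k \<times> cbox a b)"
    have k: "k \<in> Basis" "k \<notin> S" using insert by auto
    have prod: "Z k \<times> cbox a b \<in> sets (borel :: ('a \<times> 'a) measure)"
      using shadow(1)[OF k(1)] by (intro borel_Times) auto
    have V: "V \<in> sets borel"
      using measurable_sets[OF coord_swap_preserves_lborel(1) prod] by (simp add: V_def)
    have "emeasure lborel V = emeasure (distr lborel borel (coord_swap S)) (Z k \<times> cbox a b)"
      using coord_swap_preserves_lborel(1)[of S] prod by (simp add: emeasure_distr V_def)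
    also have "\<dots> = emeasure (lborel \<Otimes>\<^sub>M lborel) (Z k \<times> cbox a b)"
      by (simp add: coord_swap_preserves_lborel lborel_prod)
    also have "\<dots> = emeasure lborel (Z k) * emeasure lborel (cbox a b)"
      using shadow(1)[OF k(1)] by (intro lborel.emeasure_pair_measure_Times) auto
    finally have emV: "emeasure lborel V = emeasure lborel (Z k) * emeasure lborel (cbox a b)" .
    \<comment> \<open>The walk through \<open>coord_merge S x y\<close> either has already changed sides or does so at \<open>k\<close>.\<close>
    have sub: "(x, y) \<in> W \<union> V"
      if xy: "x \<in> cbox a b" "y \<in> cbox a b" and ne: "x \<in> \<Omega> \<longleftrightarrow> coord_merge (insert k S) x y \<notin> \<Omega>" for x y
    proof (cases "x \<in> \<Omega> \<longleftrightarrow> coord_merge S x y \<in> \<Omega>")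
      case True
      let ?x' = "coord_merge S x y" and ?y' = "coord_merge S y x"
      \<comment> \<open>Since \<open>k\<close> is not in \<open>S\<close>, the partner
        \<open>?y'\<close> still has the \<open>k\<close>-th coordinate of \<open>y\<close>.\<close>
      have "coord_merge (insert k S) x y = coord_merge {k} ?x' ?y'"
        by (rule euclidean_eqI) (use k in auto)
      then have "?x' \<in> \<Omega> \<longleftrightarrow> coord_merge {k} ?x' ?y' \<notin> \<Omega>"
        using True ne by metis
      then have "?x' \<in> Z k"
        using xy by (intro shadow(2)[OF k(1), of _ ?y'] coord_merge_in_cbox)
      then show ?thesis
        using xy by (simp add: V_def coord_swap_def coord_merge_in_cbox)
    next
      case False
      then have "(x, y) \<in> W" using xy by (intro W(2)) blast+
      then show ?thesis by blast
    qed
    have "emeasure lborel (W \<union> V) \<le> emeasure lborel W + emeasure lborel V"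
      using W(1) V by (intro emeasure_subadditive) auto
    also have "\<dots> \<le> (\<Sum>k\<in>insert k S. emeasure lborel (Z k)) * emeasure lborel (cbox a b)"
      using W(3) insert.hyps by (simp add: emV distrib_right add.commute)
    finally show ?case
      using W(1) V by (intro bexI[of _ "W \<union> V"] conjI subsetI) (auto dest: sub)
  qed
  then show thesis using that by blast
qed

text \<open>For \<open>S = Basis\<close> the walk ends at \<open>y\<close>, so the mismatch set
  contains the product of \<open>cbox a b \<inter> \<Omega>\<close> and
  \<open>cbox a b - \<Omega>\<close>.\<close>

lemma relative_isoperimetric_shadow:
  fixes \<Omega> :: "'a::euclidean_space set"
  assumes \<Omega>: "\<Omega> \<in> sets borel"
    and shadow: "\<And>k. k \<in> Basis \<Longrightarrow> Z k \<in> sets borel"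
      "\<And>k x y. k \<in> Basis \<Longrightarrow> x \<in> cbox a b \<Longrightarrow> y \<in> cbox a b \<Longrightarrow>
         x \<in> \<Omega> \<longleftrightarrow> coord_merge {k} x y \<notin> \<Omega> \<Longrightarrow> x \<in> Z k"
  shows "emeasure lborel (cbox a b \<inter> \<Omega>) * emeasure lborel (cbox a b - \<Omega>)
           \<le> (\<Sum>k\<in>Basis. emeasure lborel (Z k)) * emeasure lborel (cbox a b)"
proof -
  obtain W where W: "W \<in> sets borel"
    "{(x, y). x \<in> cbox a b \<and> y \<in> cbox a b \<and> (x \<in> \<Omega> \<longleftrightarrow> coord_merge Basis x y \<notin> \<Omega>)} \<subseteq> W"
    "emeasure lborel W \<le> (\<Sum>k\<in>Basis. emeasure lborel (Z k)) * emeasure lborel (cbox a b)"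
    by (rule emeasure_mismatch_le[OF subset_refl assms])
  have "emeasure lborel (cbox a b \<inter> \<Omega>) * emeasure lborel (cbox a b - \<Omega>)
      = emeasure (lborel \<Otimes>\<^sub>M lborel) ((cbox a b \<inter> \<Omega>) \<times> (cbox a b - \<Omega>))"
    using \<Omega> by (intro lborel.emeasure_pair_measure_Times[symmetric]) auto
  also have "\<dots> \<le> emeasure lborel W"
    unfolding lborel_prod using W by (intro emeasure_mono) auto
  finally show ?thesis using W(3) by simp
qed

text \<open>A segment is connected, so it cannot pass between \<open>\<Omega>\<close> and its
  complement without meeting the frontier; on this one only the \<open>k\<close>-th coordinate
  varies.\<close>

lemma frontier_meets_axis_segment:
  fixes \<Omega> :: "'a::euclidean_space set"
  assumes k: "k \<in> Basis" and xy: "x \<in> cbox a b" "y \<in> cbox a b"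
    and ne: "x \<in> \<Omega> \<longleftrightarrow> coord_merge {k} x y \<notin> \<Omega>"
  obtains z where "z \<in> frontier \<Omega>" "z \<in> cbox a b" "\<And>c. c \<in> Basis - {k} \<Longrightarrow> z \<bullet> c = x \<bullet> c"
proof -
  let ?x' = "coord_merge {k} x y"
  have "closed_segment x ?x' \<inter> frontier \<Omega> \<noteq> {}"
    using ne by (intro connected_Int_frontier) auto
  then obtain z where z: "z \<in> closed_segment x ?x'" "z \<in> frontier \<Omega>" by blast
  moreover have "closed_segment x ?x' \<subseteq> cbox a b"
    using xy by (intro closed_segment_subset coord_merge_in_cbox convex_box) auto
  moreover have "z \<bullet> c = x \<bullet> c" if "c \<in> Basis - {k}" for c
    using z(1) that by (auto simp: closed_segment_def inner_add_left left_diff_distrib)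
  ultimately show thesis using that by blast
qed

text \<open>The shadow of each cover set lies in a cylinder around a chosen point \<open>u i\<close>
  with half-width \<open>diameter (U i)\<close>. Summing the cylinder volumes bounds the shadow of
  the frontier.\<close>

lemma relative_isoperimetric_cover:
  fixes \<Omega> :: "'a::euclidean_space set" and I :: "nat set"
  assumes \<Omega>: "\<Omega> \<in> sets borel" and ne: "cbox a b \<noteq> {}"
    and U: "\<And>i. i \<in> I \<Longrightarrow> U i \<noteq> {} \<and> bounded (U i)"
    and cover: "frontier \<Omega> \<inter> cbox a b \<subseteq> (\<Union>i\<in>I. U i)"
  shows "emeasure lborel (cbox a b \<inter> \<Omega>) * emeasure lborel (cbox a b - \<Omega>)
      \<le> (\<Sum>k\<in>Basis. ennreal ((b - a) \<bullet> k * 2 ^ (DIM('a) - 1)) *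
            (\<Sum>\<^sub>\<infinity>i\<in>I. ennreal (diameter (U i) ^ (DIM('a) - 1)))) * emeasure lborel (cbox a b)"
proof -
  let ?n = "DIM('a) - 1"
  have d: "0 \<le> diameter (U i)" if "i \<in> I" for i
    using U[OF that] by (simp add: diameter_ge_0)
  have le: "a \<bullet> k \<le> b \<bullet> k" if "k \<in> Basis" for k
    using ne that by (simp add: box_ne_empty)
  define u where "u i = (SOME z. z \<in> U i)" for i
  have u: "u i \<in> U i" if "i \<in> I" for i
    unfolding u_def using U[OF that] by (simp add: some_in_eq)
  define Z where "Z k i = {x \<in> cbox a b. \<forall>c\<in>Basis - {k}. \<bar>x \<bullet> c - u i \<bullet> c\<bar> \<le> diameter (U i)}" for k i
  have Z: "Z k i \<in> sets borel"
    "emeasure lborel (Z k i) \<le> ennreal ((b - a) \<bullet> k * (2 * diameter (U i)) ^ ?n)"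
    if "k \<in> Basis" "i \<in> I" for k i
    using emeasure_cylinder_le[OF that(1) d[OF that(2)] le[OF that(1)], of "u i"]
    by (simp_all add: Z_def)
  have shadow: "x \<in> (\<Union>i\<in>I. Z k i)"
    if k: "k \<in> Basis" and xy: "x \<in> cbox a b" "y \<in> cbox a b"
      and ne: "x \<in> \<Omega> \<longleftrightarrow> coord_merge {k} x y \<notin> \<Omega>" for k x y
  proof -
    obtain z where z: "z \<in> frontier \<Omega>" "z \<in> cbox a b" "\<And>c. c \<in> Basis - {k} \<Longrightarrow> z \<bullet> c = x \<bullet> c"
      by (rule frontier_meets_axis_segment[OF k xy ne]) blast
    then obtain i where i: "i \<in> I" "z \<in> U i" using cover by auto
    have "\<bar>x \<bullet> c - u i \<bullet> c\<bar> \<le> diameter (U i)" if c: "c \<in> Basis - {k}" for c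
    proof -
      have "\<bar>(z - u i) \<bullet> c\<bar> \<le> norm (z - u i)"
        using c by (intro Basis_le_norm) auto
      also have "\<dots> \<le> diameter (U i)"
        using diameter_bounded_bound[of "U i" z "u i"] U[OF i(1)] u[OF i(1)] i(2) by (simp add: dist_norm)
      finally show ?thesis using z(3)[OF c] by (simp add: inner_diff_left)
    qed
    then have "x \<in> Z k i" using xy by (simp add: Z_def)
    then show ?thesis using i(1) by blast
  qed
  have "emeasure lborel (\<Union>i\<in>I. Z k i)
      \<le> ennreal ((b - a) \<bullet> k * 2 ^ ?n) * (\<Sum>\<^sub>\<infinity>i\<in>I. ennreal (diameter (U i) ^ ?n))"
    if k: "k \<in> Basis" for k
  proof -
    have "emeasure lborel (\<Union>i\<in>I. Z k i) \<le> (\<Sum>\<^sub>\<infinity>i\<in>I. emeasure lborel (Z k i))"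
      using Z(1)[OF k] by (intro emeasure_UN_le_infsum) auto
    also have "\<dots> \<le> (\<Sum>\<^sub>\<infinity>i\<in>I. ennreal ((b - a) \<bullet> k * 2 ^ ?n) * ennreal (diameter (U i) ^ ?n))"
    proof (rule infsum_mono)
      fix i assume i: "i \<in> I"
      show "emeasure lborel (Z k i) \<le> ennreal ((b - a) \<bullet> k * 2 ^ ?n) * ennreal (diameter (U i) ^ ?n)"
        using Z(2)[OF k i] d[OF i] le[OF k]
        by (simp add: ennreal_mult[symmetric] inner_diff_left power_mult_distrib mult.assoc)
    qed (simp_all add: nonneg_summable_on_complete)
    also note infsum_cmult_le_ennreal
    finally show ?thesis .
  qed
  moreover have "emeasure lborel (cbox a b \<inter> \<Omega>) * emeasure lborel (cbox a b - \<Omega>)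
      \<le> (\<Sum>k\<in>Basis. emeasure lborel (\<Union>i\<in>I. Z k i)) * emeasure lborel (cbox a b)"
    using Z(1) shadow by (intro relative_isoperimetric_shadow \<Omega>) (auto intro!: sets.countable_UN')
  ultimately show ?thesis
    by (elim order_trans) (intro mult_right_mono sum_mono, auto)
qed

section \<open>Cubes that are partly filled by the domain\<close>

text \<open>The closed ball of radius \<open>h\<close> in the maximum norm; \<open>h\<close> is half
  the side.\<close>

definition centred_cube :: "'a::euclidean_space \<Rightarrow> real \<Rightarrow> 'a set" where
  "centred_cube x h = cbox (x - h *\<^sub>R One) (x + h *\<^sub>R One)"

lemma mem_centred_cube: "y \<in> centred_cube x h \<longleftrightarrow> (\<forall>b\<in>Basis. \<bar>(y - x) \<bullet> b\<bar> \<le> h)"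
  unfolding centred_cube_def mem_box
  by (intro ball_cong refl) (auto simp: inner_diff_left inner_add_left abs_le_iff)

lemma measure_centred_cube:
  "0 \<le> h \<Longrightarrow> measure lborel (centred_cube (x::'a::euclidean_space) h) = (2 * h) ^ DIM('a)"
  unfolding centred_cube_def
  by (simp add: measure_lborel_cbox_eq inner_diff_left inner_add_left)

lemma centred_cube_measurable [measurable, simp]: "centred_cube x h \<in> sets borel"
  by (simp add: centred_cube_def)

lemma compact_centred_cube: "compact (centred_cube x h)"
  by (simp add: centred_cube_def)

lemma emeasure_centred_cube_finite: "emeasure lborel (centred_cube x h \<inter> A) < top"
proof -
  have "emeasure lborel (centred_cube x h \<inter> A) \<le> emeasure lborel (centred_cube x h)"
    by (intro emeasure_mono) auto
  also have "\<dots> < top"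
    using emeasure_lborel_cbox_finite by (simp add: centred_cube_def)
  finally show ?thesis .
qed

lemma centred_cube_mono: "h \<le> h' \<Longrightarrow> centred_cube x h \<subseteq> centred_cube x h'"
  by (force simp: mem_centred_cube)

lemma centred_cube_subset_cball:
  "centred_cube (x::'a::euclidean_space) h \<subseteq> cball x (real DIM('a) * h)"
proof
  fix y assume y: "y \<in> centred_cube x h"
  have "norm (y - x) \<le> (\<Sum>b\<in>Basis. \<bar>(y - x) \<bullet> b\<bar>)"
    by (rule norm_le_l1)
  also have "\<dots> \<le> real DIM('a) * h"
    using y by (intro sum_bounded_above) (auto simp: mem_centred_cube)
  finally show "y \<in> cball x (real DIM('a) * h)"
    by (simp add: dist_norm norm_minus_commute)
qed

text \<open>The filled fraction lies between \<open>1 / 2 ^ (DIM('a) + 1)\<close> and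
  \<open>1 / 2\<close>. The lower bound is what survives when a cube more than half filled is
  doubled: volume grows by \<open>2 ^ DIM('a)\<close>.\<close>

definition balanced_cube :: "'a::euclidean_space set \<Rightarrow> 'a \<Rightarrow> real \<Rightarrow> bool" where
  "balanced_cube \<Omega> x h \<longleftrightarrow> 0 < h \<and>
     2 * measure lborel (centred_cube x h \<inter> \<Omega>) \<le> (2 * h) ^ DIM('a) \<and>
     (2 * h) ^ DIM('a) \<le> 2 ^ (DIM('a) + 1) * measure lborel (centred_cube x h \<inter> \<Omega>)"

lemma balanced_cube_power_le:
  fixes x :: "'a::euclidean_space"
  assumes "balanced_cube \<Omega> x h"
  shows "h ^ DIM('a) \<le> 2 * measure lborel (centred_cube x h \<inter> \<Omega>)"
proof -
  have "2 ^ DIM('a) * h ^ DIM('a) \<le> 2 ^ DIM('a) * (2 * measure lborel (centred_cube x h \<inter> \<Omega>))"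
    using assms by (simp add: balanced_cube_def power_mult_distrib)
  then show ?thesis
    by (subst (asm) mult_le_cancel_left_pos) auto
qed

text \<open>The first cube in a dyadic sequence, starting inside \<open>\<Omega>\<close>, that is at most half filled.\<close>

lemma ex_balanced_cube:
  fixes \<Omega> :: "'a::euclidean_space set"
  assumes "open \<Omega>" "emeasure lborel \<Omega> < \<infinity>" "x \<in> \<Omega>"
  obtains h where "balanced_cube \<Omega> x h"
proof -
  let ?n = "DIM('a)"
  define m where "m h = measure lborel (centred_cube x h \<inter> \<Omega>)" for h
  obtain e where e: "0 < e" "cball x e \<subseteq> \<Omega>"
    using assms open_contains_cball by blast
  \<comment> \<open>A cube of half-side \<open>h\<close> lies in the ball of radius
    \<open>?n * h\<close>, so the first cube is contained in \<open>\<Omega>\<close>.\<close>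
  define h0 where "h0 = e / real ?n"
  have h0: "0 < h0" using e by (simp add: h0_def)
  have "centred_cube x h0 \<subseteq> \<Omega>"
    using centred_cube_subset_cball[of x h0] e by (simp add: h0_def)
  then have m0: "m h0 = (2 * h0) ^ ?n"
    using h0 by (simp add: m_def Int_absorb2 measure_centred_cube)
  have mono: "m h \<le> m h'" if "h \<le> h'" for h h'
    unfolding m_def using centred_cube_mono[OF that, of x] assms(1)
    by (intro measure_mono_fmeasurable) (auto simp: fmeasurable_def emeasure_centred_cube_finite)
  have m_le: "m h \<le> measure lborel \<Omega>" for h
    unfolding m_def using assms(1,2)
    by (intro measure_mono_fmeasurable) (auto simp: fmeasurable_def)
  define P where "P k \<longleftrightarrow> 2 * m (2 ^ k * h0) \<le> (2 * (2 ^ k * h0)) ^ ?n" for k :: nat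
  have "\<exists>k. P k"
  proof -
    obtain k where k: "max 1 (2 * measure lborel \<Omega>) / h0 < 2 ^ k"
      using real_arch_pow[of 2] by auto
    then have "max 1 (2 * measure lborel \<Omega>) < 2 ^ k * h0"
      using h0 by (simp add: pos_divide_less_eq)
    \<comment> \<open>Once the side exceeds both bounds, it dominates twice the measure of
      \<open>\<Omega>\<close>, and being at least 1 it is at most its own \<open>?n\<close>-th
      power.\<close>
    then have ge: "max 1 (2 * measure lborel \<Omega>) \<le> 2 * (2 ^ k * h0)" using h0 by simp
    have "2 * m (2 ^ k * h0) \<le> 2 * (2 ^ k * h0)"
      using ge m_le[of "2 ^ k * h0"] by linarith
    also have "\<dots> \<le> (2 * (2 ^ k * h0)) ^ ?n"
      using ge by (intro self_le_power) auto
    finally show ?thesis unfolding P_def by blast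
  qed
  define k where "k = (LEAST k. P k)"
  have Pk: "P k" unfolding k_def using \<open>\<exists>k. P k\<close> by (rule LeastI_ex)
  have "\<not> P 0"
    using h0 by (simp add: P_def m0)
  then obtain j where j: "k = Suc j" using Pk by (cases k) auto
  \<comment> \<open>By minimality the previous cube is more than half filled, and it is contained in
    its double.\<close>
  then have "\<not> P j"
    using not_less_Least[of j P] by (simp add: k_def)
  then have "(2 * (2 ^ j * h0)) ^ ?n \<le> 2 * m (2 ^ k * h0)"
    using mono[of "2 ^ j * h0" "2 ^ k * h0"] h0 j by (simp add: P_def)
  moreover have "(2 * (2 ^ k * h0)) ^ ?n = 2 ^ ?n * (2 * (2 ^ j * h0)) ^ ?n"
    by (simp only: j power_Suc power_mult_distrib mult.assoc)
  ultimately have "(2 * (2 ^ k * h0)) ^ ?n \<le> 2 ^ ?n * (2 * m (2 ^ k * h0))"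
    by (simp add: mult_left_mono)
  then have "balanced_cube \<Omega> x (2 ^ k * h0)"
    using Pk h0 by (simp add: balanced_cube_def P_def m_def)
  then show thesis by (rule that)
qed

text \<open>With \<open>A\<close> and \<open>D\<close> the volumes inside and outside
  \<open>\<Omega>\<close>, the isoperimetric bound controls \<open>A * D\<close>, and
  \<open>D\<close> is at least half the cube. Cancelling the cube volume leaves \<open>A\<close>
  bounded by a multiple of \<open>h * s\<close>; as \<open>h ^ DIM('a) \<le> 2 * A\<close>, one
  factor \<open>h\<close> cancels.\<close>

lemma balanced_cube_frontier_cover:
  fixes \<Omega> :: "'a::euclidean_space set" and I :: "nat set"
  assumes \<Omega>: "\<Omega> \<in> sets borel" and h: "balanced_cube \<Omega> x h"
    and U: "\<And>i. i \<in> I \<Longrightarrow> U i \<noteq> {} \<and> bounded (U i)"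
    and cover: "frontier \<Omega> \<inter> centred_cube x h \<subseteq> (\<Union>i\<in>I. U i)"
  shows "ennreal (h ^ (DIM('a) - 1))
      \<le> ennreal (real DIM('a) * 2 ^ (DIM('a) + 2)) * (\<Sum>\<^sub>\<infinity>i\<in>I. ennreal (diameter (U i) ^ (DIM('a) - 1)))"
    (is "_ \<le> _ * ?s")
proof (cases "?s = \<infinity>")
  case True
  then show ?thesis by (simp add: ennreal_mult_top)
next
  case False
  let ?n = "DIM('a)" and ?Q = "centred_cube x h"
  \<comment> \<open>A finite cover sum is moved to the reals, where common factors can be
    cancelled.\<close>
  define s where "s = enn2real ?s"
  have s: "?s = ennreal s" "0 \<le> s" using False by (auto simp: s_def less_top)
  have h0: "0 < h" using h by (simp add: balanced_cube_def)
  define A where "A = measure lborel (?Q \<inter> \<Omega>)"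
  define D where "D = measure lborel (?Q - \<Omega>)"
  have AD0: "0 \<le> A" "0 \<le> D" by (simp_all add: A_def D_def)
  have emA: "emeasure lborel (?Q \<inter> \<Omega>) = ennreal A"
    unfolding A_def
    by (rule emeasure_eq_ennreal_measure) (use emeasure_centred_cube_finite in \<open>simp add: less_top\<close>)
  have emD: "emeasure lborel (?Q - \<Omega>) = ennreal D"
    unfolding D_def Diff_eq
    by (rule emeasure_eq_ennreal_measure) (use emeasure_centred_cube_finite in \<open>simp add: less_top\<close>)
  have emQ: "emeasure lborel ?Q = ennreal ((2 * h) ^ ?n)"
    using emeasure_eq_ennreal_measure[of lborel ?Q] emeasure_centred_cube_finite[of x h UNIV] h0
    by (simp add: less_top measure_centred_cube)
  have "emeasure lborel ?Q = emeasure lborel (?Q \<inter> \<Omega>) + emeasure lborel (?Q - \<Omega>)"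
    using \<Omega> by (subst plus_emeasure) (auto intro!: arg_cong[where f = "emeasure lborel"])
  then have AD: "(2 * h) ^ ?n = A + D"
    using h0 AD0 by (simp add: emA emD emQ flip: ennreal_plus)
  have "emeasure lborel (?Q \<inter> \<Omega>) * emeasure lborel (?Q - \<Omega>)
      \<le> (\<Sum>k\<in>(Basis::'a set). ennreal (2 * h * 2 ^ (?n - 1)) * ?s) * emeasure lborel ?Q"
    using relative_isoperimetric_cover[OF \<Omega> _ U cover[unfolded centred_cube_def]] h0
    by (simp add: centred_cube_def box_ne_empty inner_diff_left inner_add_left)
  also have "(\<Sum>k\<in>(Basis::'a set). ennreal (2 * h * 2 ^ (?n - 1)) * ?s)
      = ennreal (real ?n * (2 * h * 2 ^ (?n - 1) * s))"
    unfolding s(1) using h0 s(2) by (simp add: ennreal_mult ennreal_of_nat_eq_real_of_nat)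
  finally have le: "ennreal A * ennreal D
      \<le> ennreal (real ?n * (2 * h * 2 ^ (?n - 1) * s)) * ennreal ((2 * h) ^ ?n)"
    unfolding emA emD emQ .
  have nonneg: "0 \<le> real ?n * (2 * h * 2 ^ (?n - 1) * s)" "0 \<le> (2 * h) ^ ?n"
    using h0 s(2) by simp_all
  have "A * D \<le> real ?n * (2 * h * 2 ^ (?n - 1) * s) * (2 * h) ^ ?n"
    using le ennreal_le_iff[OF mult_nonneg_nonneg[OF nonneg]]
    unfolding ennreal_mult[OF AD0, symmetric] ennreal_mult[OF nonneg, symmetric] by blast
  moreover have pow: "z ^ ?n = z * z ^ (?n - 1)" for z :: real
    by (simp flip: power_Suc)
  ultimately have "A * D \<le> real ?n * (2 ^ ?n * h * s) * (2 * h) ^ ?n"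
    unfolding pow[of 2] by (simp only: ac_simps)
  \<comment> \<open>At most half filled means \<open>A \<le> D\<close>, so the cube volume
    \<open>A + D\<close> is at most \<open>2 * D\<close>.\<close>
  moreover have "A * (2 * h) ^ ?n \<le> A * (2 * D)"
    using h AD by (intro mult_left_mono) (auto simp: balanced_cube_def A_def)
  then have "A * (2 * h) ^ ?n \<le> 2 * (A * D)"
    by (simp only: ac_simps)
  ultimately have "A * (2 * h) ^ ?n \<le> 2 * (real ?n * (2 ^ ?n * h * s) * (2 * h) ^ ?n)"
    by linarith
  then have "A * (2 * h) ^ ?n \<le> (2 * real ?n * (2 ^ ?n * h * s)) * (2 * h) ^ ?n"
    by (simp only: mult.assoc)
  then have "A \<le> 2 * real ?n * (2 ^ ?n * h * s)"
    using h0 by (subst (asm) mult_le_cancel_right_pos) auto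
  moreover have "h * h ^ (?n - 1) \<le> 2 * A"
    using balanced_cube_power_le[OF h] pow[of h] by (simp add: A_def)
  ultimately have "h * h ^ (?n - 1) \<le> 2 * (2 * real ?n * (2 ^ ?n * h * s))"
    by linarith
  also have "\<dots> = h * (real ?n * 2 ^ (?n + 2) * s)"
    by (simp add: power_add)
  finally have "h * h ^ (?n - 1) \<le> h * (real ?n * 2 ^ (?n + 2) * s)" .
  then have "h ^ (?n - 1) \<le> real ?n * 2 ^ (?n + 2) * s"
    using h0 by (subst (asm) mult_le_cancel_left_pos) auto
  then show ?thesis
    unfolding s(1) using s(2) by (simp flip: ennreal_mult)
qed

section \<open>Summation over disjoint balanced cubes\<close>

text \<open>Each pair of disjoint compact sets has a positive gap, and there are finitely many
  pairs. The filter \<open>at_right 0\<close> replaces a minimum of the gaps; it also handles the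
  case of no pairs and gives the strict inequality.\<close>

lemma separate_finite_compact:
  fixes Q :: "'b \<Rightarrow> 'a::heine_borel set"
  assumes "finite F" "\<And>x. x \<in> F \<Longrightarrow> compact (Q x)"
    and "\<And>x y. x \<in> F \<Longrightarrow> y \<in> F \<Longrightarrow> x \<noteq> y \<Longrightarrow> Q x \<inter> Q y = {}"
  shows "\<exists>\<delta>>0. \<forall>x\<in>F. \<forall>y\<in>F. x \<noteq> y \<longrightarrow> (\<forall>p\<in>Q x. \<forall>q\<in>Q y. \<delta> < dist p q)"
proof -
  define P where "P z \<delta> \<longleftrightarrow> fst z \<noteq> snd z \<longrightarrow> (\<forall>p\<in>Q (fst z). \<forall>q\<in>Q (snd z). \<delta> < dist p q)"
    for z :: "'b \<times> 'b" and \<delta> :: real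
  have "\<forall>\<^sub>F \<delta> in at_right 0. P z \<delta>" if z: "z \<in> F \<times> F" for z
  proof (cases "fst z = snd z")
    case False
    then obtain d where "0 < d" "\<forall>p\<in>Q (fst z). \<forall>q\<in>Q (snd z). d \<le> dist p q"
      using separate_compact_closed[of "Q (fst z)" "Q (snd z)"] assms(2,3) z compact_imp_closed
      by (metis mem_Sigma_iff prod.collapse)
    then show ?thesis
      unfolding eventually_at_right_field P_def by force
  qed (simp add: P_def)
  then have "\<forall>\<^sub>F \<delta> in at_right 0. \<forall>z\<in>F \<times> F. P z \<delta>"
    using assms(1) by (intro eventually_ball_finite) auto
  then have "\<forall>\<^sub>F \<delta> in at_right 0. 0 < \<delta> \<and> (\<forall>z\<in>F \<times> F. P z \<delta>)"
    using eventually_at_right_less by (rule eventually_conj[rotated])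
  then obtain \<delta> where "0 < \<delta>" "\<forall>z\<in>F \<times> F. P z \<delta>"
    using eventually_happens'[OF trivial_limit_at_right_real] by blast
  then show ?thesis by (intro exI[of _ \<delta>]) (auto simp: P_def)
qed

text \<open>A sufficiently fine cover of the frontier splits into disjoint subfamilies, one for each
  cube, so the bounds for single cubes add up against one cover. The premeasure at that scale is
  below the Hausdorff measure.\<close>

lemma balanced_cubes_hausdorff:
  fixes \<Omega> :: "'a::euclidean_space set"
  assumes \<Omega>: "\<Omega> \<in> sets borel" and F: "finite F" and h: "\<And>x. x \<in> F \<Longrightarrow> balanced_cube \<Omega> x (h x)"
    and disj: "\<And>x y. x \<in> F \<Longrightarrow> y \<in> F \<Longrightarrow> x \<noteq> y \<Longrightarrow> centred_cube x (h x) \<inter> centred_cube y (h y) = {}"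
  shows "(\<Sum>x\<in>F. ennreal (h x ^ (DIM('a) - 1)))
      \<le> ennreal (real DIM('a) * 2 ^ (DIM('a) + 2)) * hausdorff_measure (DIM('a) - 1) (frontier \<Omega>)"
proof -
  let ?n = "DIM('a)" and ?Q = "\<lambda>x. centred_cube x (h x)"
  define c where "c = real ?n * 2 ^ (?n + 2)"
  have c: "0 < c" by (simp add: c_def)
  \<comment> \<open>A set of diameter at most \<open>\<delta>\<close> meets at most one of the cubes.\<close>
  have "\<exists>\<delta>>0. \<forall>x\<in>F. \<forall>y\<in>F. x \<noteq> y \<longrightarrow> (\<forall>p\<in>?Q x. \<forall>q\<in>?Q y. \<delta> < dist p q)"
    using F compact_centred_cube disj by (rule separate_finite_compact)
  then obtain \<delta> where \<delta>: "0 < \<delta>"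
    "\<And>x y p q. x \<in> F \<Longrightarrow> y \<in> F \<Longrightarrow> x \<noteq> y \<Longrightarrow> p \<in> ?Q x \<Longrightarrow> q \<in> ?Q y \<Longrightarrow> \<delta> < dist p q"
    by blast
  let ?S = "\<Sum>x\<in>F. ennreal (h x ^ (?n - 1))"
  \<comment> \<open>The constant goes to the left so that the claim is a lower bound for every cover
    sum, as the infimum requires.\<close>
  have "ennreal (1 / c) * ?S \<le> hausdorff_premeasure (?n - 1) \<delta> (frontier \<Omega>)"
    unfolding hausdorff_premeasure_def
  proof (rule Inf_greatest, clarify)
    fix I :: "nat set" and U :: "nat \<Rightarrow> 'a set"
    assume U: "\<forall>i\<in>I. U i \<noteq> {} \<and> bounded (U i) \<and> diameter (U i) \<le> \<delta>"
      and cover: "frontier \<Omega> \<subseteq> (\<Union>i\<in>I. U i)"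
    let ?f = "\<lambda>i. ennreal (diameter (U i) ^ (?n - 1))"
    define J where "J x = {i \<in> I. U i \<inter> ?Q x \<noteq> {}}" for x
    have "J x \<inter> J y = {}" if xy: "x \<in> F" "y \<in> F" "x \<noteq> y" for x y
    proof (rule ccontr)
      assume "J x \<inter> J y \<noteq> {}"
      then obtain i p q where i: "i \<in> I" and p: "p \<in> U i" "p \<in> ?Q x" and q: "q \<in> U i" "q \<in> ?Q y"
        by (auto simp: J_def)
      have "dist p q \<le> diameter (U i)"
        using U i p q by (intro diameter_bounded_bound) auto
      also have "\<dots> \<le> \<delta>" using U i by blast
      finally show False using \<delta>(2)[OF xy p(2) q(2)] by simp
    qed
    then have J: "(\<Sum>x\<in>F. infsum ?f (J x)) \<le> infsum ?f I"
      by (intro sum_infsum_disjoint_le_ennreal F) (auto simp: J_def)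
    have "?S \<le> (\<Sum>x\<in>F. ennreal c * infsum ?f (J x))"
    proof (rule sum_mono)
      fix x assume x: "x \<in> F"
      have "frontier \<Omega> \<inter> ?Q x \<subseteq> (\<Union>i\<in>J x. U i)"
        using cover by (fastforce simp: J_def)
      then show "ennreal (h x ^ (?n - 1)) \<le> ennreal c * infsum ?f (J x)"
        unfolding c_def using U by (intro balanced_cube_frontier_cover[OF \<Omega> h[OF x]]) (auto simp: J_def)
    qed
    also have "\<dots> \<le> ennreal c * infsum ?f I"
      unfolding sum_distrib_left[symmetric] by (intro mult_left_mono J) simp
    finally have "ennreal (1 / c) * ?S \<le> ennreal (1 / c) * (ennreal c * infsum ?f I)"
      by (rule mult_left_mono) simp
    also have "\<dots> = infsum ?f I"
      using c by (simp flip: mult.assoc ennreal_mult)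
    finally show "ennreal (1 / c) * ?S \<le> infsum ?f I" .
  qed
  also have "\<dots> \<le> hausdorff_measure (?n - 1) (frontier \<Omega>)"
    unfolding hausdorff_measure_def using \<delta>(1) by (intro SUP_upper) simp
  finally have "ennreal c * (ennreal (1 / c) * ?S) \<le> ennreal c * hausdorff_measure (?n - 1) (frontier \<Omega>)"
    by (rule mult_left_mono) simp
  moreover have "ennreal c * (ennreal (1 / c) * ?S) = ?S"
    using c by (simp flip: mult.assoc ennreal_mult)
  ultimately show ?thesis by (simp add: c_def)
qed

lemma balanced_cubes_measure:
  fixes \<Omega> :: "'a::euclidean_space set"
  assumes \<Omega>: "\<Omega> \<in> sets borel" and F: "finite F" and h: "\<And>x. x \<in> F \<Longrightarrow> balanced_cube \<Omega> x (h x)"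
    and disj: "\<And>x y. x \<in> F \<Longrightarrow> y \<in> F \<Longrightarrow> x \<noteq> y \<Longrightarrow> centred_cube x (h x) \<inter> centred_cube y (h y) = {}"
  shows "(\<Sum>x\<in>F. ennreal (h x ^ DIM('a))) \<le> 2 * emeasure lborel \<Omega>"
proof -
  let ?n = "DIM('a)" and ?Q = "\<lambda>x. centred_cube x (h x)"
  have "ennreal (h x ^ ?n) \<le> 2 * emeasure lborel (?Q x \<inter> \<Omega>)" if "x \<in> F" for x
  proof -
    have "ennreal (h x ^ ?n) \<le> ennreal (2 * measure lborel (?Q x \<inter> \<Omega>))"
      by (rule ennreal_leI[OF balanced_cube_power_le[OF h[OF that]]])
    also have "\<dots> = 2 * emeasure lborel (?Q x \<inter> \<Omega>)"
      using emeasure_centred_cube_finite[of x "h x" \<Omega>]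
      by (simp add: emeasure_eq_ennreal_measure less_top ennreal_mult)
    finally show ?thesis .
  qed
  then have "(\<Sum>x\<in>F. ennreal (h x ^ ?n)) \<le> (\<Sum>x\<in>F. 2 * emeasure lborel (?Q x \<inter> \<Omega>))"
    by (rule sum_mono)
  also have "\<dots> = 2 * (\<Sum>x\<in>F. emeasure lborel (?Q x \<inter> \<Omega>))"
    by (simp add: sum_distrib_left)
  also have "(\<Sum>x\<in>F. emeasure lborel (?Q x \<inter> \<Omega>)) = emeasure lborel (\<Union>x\<in>F. ?Q x \<inter> \<Omega>)"
    using F disj \<Omega> by (intro sum_emeasure) (auto simp: disjoint_family_on_def)
  also have "\<dots> \<le> emeasure lborel \<Omega>"
    using \<Omega> by (intro emeasure_mono) auto
  finally show ?thesis by (simp add: mult_left_mono)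
qed

section \<open>From Vitali covers to the mixed content\<close>

text \<open>Vitali's lemma indexes the cover by a countable set of centres, while
  \<open>mixed_content\<close> uses index sets of naturals; \<open>to_nat_on\<close>
  translates.\<close>

lemma mixed_content_le_countable:
  assumes C: "countable C" and U: "\<And>x. x \<in> C \<Longrightarrow> U x \<in> \<F>" and cover: "E \<subseteq> (\<Union>x\<in>C. U x)"
  shows "mixed_content \<F> lam (E :: 'a::euclidean_space set)
    \<le> (\<Sum>\<^sub>\<infinity>x\<in>C. ennreal (mixed_gauge DIM('a) lam (diameter (U x))))"
proof -
  define I where "I = to_nat_on C ` C"
  define V where "V = U \<circ> from_nat_into C"
  have V: "V (to_nat_on C x) = U x" if "x \<in> C" for x
    using C that by (simp add: V_def)
  have "mixed_content \<F> lam E \<le> (\<Sum>\<^sub>\<infinity>i\<in>I. ennreal (mixed_gauge DIM('a) lam (diameter (V i))))"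
    unfolding mixed_content_def using U cover by (intro Inf_lower) (force simp: I_def V)
  also have "\<dots> = (\<Sum>\<^sub>\<infinity>x\<in>C. ennreal (mixed_gauge DIM('a) lam (diameter (V (to_nat_on C x)))))"
    unfolding I_def by (subst infsum_reindex) (simp_all add: C inj_on_to_nat_on o_def)
  also have "\<dots> = (\<Sum>\<^sub>\<infinity>x\<in>C. ennreal (mixed_gauge DIM('a) lam (diameter (U x))))"
    by (intro infsum_cong) (simp add: V)
  finally show ?thesis .
qed

lemma mixed_gauge_le:
  assumes "0 \<le> d" "d \<le> r" "0 \<le> lam"
  shows "mixed_gauge n lam d \<le> r ^ n + lam * r ^ (n - 1)"
  using assms by (auto simp: mixed_gauge_def intro!: add_mono mult_left_mono power_mono)

text \<open>The assumption on \<open>\<F>\<close> captures what balls and cubes share: each ball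
  sits in a member of comparable diameter.\<close>

lemma mixed_content_le_measure_frontier:
  fixes \<F> :: "'a::euclidean_space set set"
  assumes K: "0 < K"
    and \<F>: "\<And>x r. 0 < r \<Longrightarrow> \<exists>U\<in>\<F>. cball x r \<subseteq> U \<and> bounded U \<and> diameter U \<le> K * r"
  shows "\<exists>C>0. \<forall>\<Omega> lam. bounded \<Omega> \<and> open \<Omega> \<and> 0 < lam \<longrightarrow>
    mixed_content \<F> lam \<Omega> \<le> ennreal C *
      (emeasure lebesgue \<Omega> + ennreal lam * hausdorff_measure (DIM('a) - 1) (frontier \<Omega>))"
proof -
  let ?n = "DIM('a)"
  \<comment> \<open>The factor 5 is Vitali's enlargement, and \<open>?n\<close> is the ratio between
    a circumscribed ball's radius and the half-side \<open>h\<close>.\<close>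
  define \<kappa> where "\<kappa> = K * (5 * real ?n)"
  define c where "c = real ?n * 2 ^ (?n + 2)"
  define C where "C = \<kappa> ^ ?n * 2 + \<kappa> ^ (?n - 1) * c"
  have pos: "0 < \<kappa>" "0 < c" using K by (simp_all add: \<kappa>_def c_def)
  have "mixed_content \<F> lam \<Omega> \<le> ennreal C *
      (emeasure lebesgue \<Omega> + ennreal lam * hausdorff_measure (?n - 1) (frontier \<Omega>))"
    if \<Omega>: "bounded \<Omega>" "open \<Omega>" and lam: "0 < lam" for \<Omega> :: "'a set" and lam
  proof -
    let ?M = "measure lborel \<Omega>" and ?H = "hausdorff_measure (?n - 1) (frontier \<Omega>)"
    have fin: "emeasure lborel \<Omega> < \<infinity>" using \<Omega>(1) by (rule emeasure_bounded_finite)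
    have "\<exists>h. balanced_cube \<Omega> x h" if "x \<in> \<Omega>" for x
      using ex_balanced_cube[OF \<Omega>(2) fin that] by blast
    then obtain h where h: "\<And>x. x \<in> \<Omega> \<Longrightarrow> balanced_cube \<Omega> x (h x)" by metis
    have h0: "0 < h x" if "x \<in> \<Omega>" for x using h[OF that] by (simp add: balanced_cube_def)
    \<comment> \<open>Vitali's lemma needs bounded radii. A half-side above 1 is controlled by the
      cube volume, hence by the measure of \<open>\<Omega>\<close>.\<close>
    have h_le: "h x \<le> max 1 (2 ^ (?n + 1) * ?M)" if x: "x \<in> \<Omega>" for x
    proof (cases "h x \<le> 1")
      case False
      then have "h x \<le> (2 * h x) ^ ?n"
        using self_le_power[of "2 * h x" ?n] by simp
      also have "\<dots> \<le> 2 ^ (?n + 1) * measure lborel (centred_cube x (h x) \<inter> \<Omega>)"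
        using h[OF x] by (simp add: balanced_cube_def)
      also have "\<dots> \<le> 2 ^ (?n + 1) * ?M"
        using fin \<Omega>(2) by (intro mult_left_mono measure_mono_fmeasurable) (auto simp: fmeasurable_def)
      finally show ?thesis by simp
    qed simp
    \<comment> \<open>The lemma is applied to balls containing the cubes: disjoint balls force
      disjoint cubes, and the enlarged balls cover \<open>\<Omega>\<close>.\<close>
    obtain D where D: "countable D" "D \<subseteq> \<Omega>"
      "pairwise (\<lambda>x y. disjnt (cball x (real ?n * h x)) (cball y (real ?n * h y))) D"
      "\<Omega> \<subseteq> (\<Union>x\<in>D. cball x (5 * (real ?n * h x)))"
      by (rule Vitali_covering_lemma_cballs[where S = \<Omega> and K = \<Omega> and a = "\<lambda>x. x"
            and r = "\<lambda>x. real ?n * h x" and B = "real ?n * max 1 (2 ^ (?n + 1) * ?M)"])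
         (use h0 h_le in \<open>auto intro!: mult_left_mono simp: less_imp_le\<close>)
    have disj: "centred_cube x (h x) \<inter> centred_cube y (h y) = {}" if "x \<in> D" "y \<in> D" "x \<noteq> y" for x y
      using D(3) that centred_cube_subset_cball[of x "h x"] centred_cube_subset_cball[of y "h y"]
      unfolding pairwise_def disjnt_def by blast
    have "\<exists>U\<in>\<F>. cball x (5 * (real ?n * h x)) \<subseteq> U \<and> bounded U \<and> diameter U \<le> \<kappa> * h x" if "x \<in> D" for x
      using \<F>[of "5 * (real ?n * h x)" x] h0[of x] that D(2) by (auto simp: \<kappa>_def mult.assoc)
    then obtain U where U: "\<And>x. x \<in> D \<Longrightarrow> U x \<in> \<F>"
      "\<And>x. x \<in> D \<Longrightarrow> cball x (5 * (real ?n * h x)) \<subseteq> U x"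
      "\<And>x. x \<in> D \<Longrightarrow> bounded (U x)" "\<And>x. x \<in> D \<Longrightarrow> diameter (U x) \<le> \<kappa> * h x"
      by metis
    have "mixed_content \<F> lam \<Omega> \<le> (\<Sum>\<^sub>\<infinity>x\<in>D. ennreal (mixed_gauge ?n lam (diameter (U x))))"
      using D(1,4) U(1,2) by (intro mixed_content_le_countable) blast+
    also have "\<dots> \<le> ennreal C * (emeasure lborel \<Omega> + ennreal lam * ?H)"
    \<comment> \<open>Passing to finite partial sums makes a positive gap between the selected cubes
      available.\<close>
    proof (rule infsum_le_finite_sums)
      fix F assume F: "finite F" "F \<subseteq> D"
      have bal: "balanced_cube \<Omega> x (h x)" if "x \<in> F" for x using h that F D(2) by blast
      have disjF: "centred_cube x (h x) \<inter> centred_cube y (h y) = {}" if "x \<in> F" "y \<in> F" "x \<noteq> y" for x y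
        using disj that F by blast
      have "(\<Sum>x\<in>F. ennreal (mixed_gauge ?n lam (diameter (U x))))
          \<le> (\<Sum>x\<in>F. ennreal (\<kappa> ^ ?n) * ennreal (h x ^ ?n)
                + ennreal (lam * \<kappa> ^ (?n - 1)) * ennreal (h x ^ (?n - 1)))"
      proof (rule sum_mono)
        fix x assume "x \<in> F"
        then have x: "x \<in> D" "0 < h x" using F D(2) h0 by auto
        have "mixed_gauge ?n lam (diameter (U x)) \<le> (\<kappa> * h x) ^ ?n + lam * (\<kappa> * h x) ^ (?n - 1)"
          using U(3,4)[OF x(1)] lam by (intro mixed_gauge_le diameter_ge_0) auto
        then have "ennreal (mixed_gauge ?n lam (diameter (U x)))
            \<le> ennreal (\<kappa> ^ ?n * h x ^ ?n + lam * \<kappa> ^ (?n - 1) * h x ^ (?n - 1))"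
          by (intro ennreal_leI) (simp add: power_mult_distrib mult.assoc)
        also have "\<dots> = ennreal (\<kappa> ^ ?n) * ennreal (h x ^ ?n)
                + ennreal (lam * \<kappa> ^ (?n - 1)) * ennreal (h x ^ (?n - 1))"
          using x pos lam by (simp add: ennreal_mult)
        finally show "ennreal (mixed_gauge ?n lam (diameter (U x))) \<le> \<dots>" .
      qed
      also have "\<dots> = ennreal (\<kappa> ^ ?n) * (\<Sum>x\<in>F. ennreal (h x ^ ?n))
          + ennreal (lam * \<kappa> ^ (?n - 1)) * (\<Sum>x\<in>F. ennreal (h x ^ (?n - 1)))"
        by (simp add: sum.distrib sum_distrib_left)
      also have "\<dots> \<le> ennreal (\<kappa> ^ ?n) * (2 * emeasure lborel \<Omega>)
          + ennreal (lam * \<kappa> ^ (?n - 1)) * (ennreal c * ?H)"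
        unfolding c_def
        by (intro add_mono mult_left_mono balanced_cubes_measure balanced_cubes_hausdorff bal disjF F
            borel_open \<Omega>) auto
      also have "\<dots> = ennreal (\<kappa> ^ ?n * 2) * emeasure lborel \<Omega>
          + ennreal (\<kappa> ^ (?n - 1) * c) * (ennreal lam * ?H)"
        using pos lam by (simp add: ennreal_mult ac_simps)
      also have "\<dots> \<le> ennreal C * emeasure lborel \<Omega> + ennreal C * (ennreal lam * ?H)"
        using pos by (intro add_mono mult_right_mono ennreal_leI) (auto simp: C_def)
      finally show "(\<Sum>x\<in>F. ennreal (mixed_gauge ?n lam (diameter (U x))))
          \<le> ennreal C * (emeasure lborel \<Omega> + ennreal lam * ?H)"
        by (simp add: distrib_left)
    qed (simp add: nonneg_summable_on_complete)
    finally show ?thesis using \<Omega>(2) by simp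
  qed
  moreover have "0 < C" using pos by (simp add: C_def add_pos_pos)
  ultimately show ?thesis by blast
qed

section \<open>Balls and cubes as covering families\<close>

theorem theorem4p1:
  "\<forall>\<F> \<in> {balls, cubes :: (real ^ 'n) set set}.
     \<exists>C::real. C > 0 \<and>
       (\<forall>(\<Omega> :: (real ^ 'n) set) (lam::real). bounded \<Omega> \<and> lipschitz_domain \<Omega> \<and> lam > 0 \<longrightarrow>
          mixed_content \<F> lam \<Omega>
            \<le> ennreal C * (emeasure lebesgue \<Omega>
                 + ennreal lam * hausdorff_measure (CARD('n) - 1) (frontier \<Omega>)))"
proof
  fix \<F> :: "(real ^ 'n) set set"
  assume "\<F> \<in> {balls, cubes}"
  then obtain K where K: "0 < K"
    "\<And>x r. 0 < r \<Longrightarrow> \<exists>U\<in>\<F>. cball x r \<subseteq> U \<and> bounded U \<and> diameter U \<le> K * r"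
  proof (elim insertE emptyE)
    assume \<F>: "\<F> = balls"
    \<comment> \<open>Members are open, so the closed ball is placed in the open ball of twice its
      radius, which has diameter \<open>4 * r\<close>.\<close>
    show thesis
    proof (rule that[of 4])
      fix x :: "real ^ 'n" and r :: real assume "0 < r"
      then show "\<exists>U\<in>\<F>. cball x r \<subseteq> U \<and> bounded U \<and> diameter U \<le> 4 * r"
        by (intro bexI[of _ "ball x (2 * r)"]) (auto simp: \<F> balls_def intro!: exI[of _ x] exI[of _ "2 * r"])
    qed simp
  next
    assume \<F>: "\<F> = cubes"
    \<comment> \<open>The open cube of half-side \<open>2 * r\<close> contains the closed ball and
      lies in a ball of radius \<open>CARD('n) * (2 * r)\<close>, whose diameter gives the
      constant.\<close>
    show thesis
    proof (rule that[of "4 * real CARD('n)"])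
      fix x :: "real ^ 'n" and r :: real assume r: "0 < r"
      define U where "U = box (x - (2 * r) *\<^sub>R One) ((x - (2 * r) *\<^sub>R One) + (4 * r) *\<^sub>R One)"
      have eq: "x - (2 * r) *\<^sub>R One + (4 * r) *\<^sub>R One = x + (2 * r) *\<^sub>R (One :: real ^ 'n)"
        by (simp flip: scaleR_left_distrib add: algebra_simps)
      then have U: "U = box (x - (2 * r) *\<^sub>R One) (x + (2 * r) *\<^sub>R One)"
        by (simp only: U_def eq)
      have "U \<in> \<F>"
        unfolding \<F> cubes_def U_def using r by (auto intro!: exI[of _ "x - (2 * r) *\<^sub>R One"] exI[of _ "4 * r"])
      moreover have "cball x r \<subseteq> U"
      proof
        fix y assume "y \<in> cball x r"
        then have "\<bar>y \<bullet> b - x \<bullet> b\<bar> < 2 * r" if "b \<in> Basis" for b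
          using Basis_le_norm[OF that, of "y - x"] r
          by (simp add: dist_norm norm_minus_commute inner_diff_left)
        then have "x \<bullet> b - 2 * r < y \<bullet> b \<and> y \<bullet> b < x \<bullet> b + 2 * r" if "b \<in> Basis" for b
          using that by (fastforce simp: abs_less_iff)
        then show "y \<in> U"
          by (simp add: U mem_box inner_diff_left inner_add_left)
      qed
      moreover have "U \<subseteq> cball x (real CARD('n) * (2 * r))"
        using centred_cube_subset_cball[of x "2 * r"] box_subset_cbox
        unfolding U centred_cube_def by fastforce
      then have "diameter U \<le> diameter (cball x (real CARD('n) * (2 * r)))"
        by (rule diameter_subset) simp
      then have "diameter U \<le> 4 * real CARD('n) * r"
        using r by (simp add: mult_less_0_iff algebra_simps)
      moreover have "bounded U" by (simp add: U bounded_box)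
      ultimately show "\<exists>U\<in>\<F>. cball x r \<subseteq> U \<and> bounded U \<and> diameter U \<le> 4 * real CARD('n) * r"
        by blast
    qed simp
  qed
  from mixed_content_le_measure_frontier[OF this]
  show "\<exists>C::real. C > 0 \<and>
       (\<forall>(\<Omega> :: (real ^ 'n) set) (lam::real). bounded \<Omega> \<and> lipschitz_domain \<Omega> \<and> lam > 0 \<longrightarrow>
          mixed_content \<F> lam \<Omega>
            \<le> ennreal C * (emeasure lebesgue \<Omega>
                 + ennreal lam * hausdorff_measure (CARD('n) - 1) (frontier \<Omega>)))"
    unfolding lipschitz_domain_def by auto
qed

end
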